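(* Let $0<q<1$ and let $\nu>-1$ be real with $\nu\notin\{0,1,2,\dots\}$. The $q$-Macdonald function satisfies the following properties. (i) For $n$ big enough the sequence $K_\nu(q^{-n},q^2)$ has a constant sign, and $$\lim_{n\to\infty}\frac{K_\nu(q^{-n},q^2)}{K_\nu(q^{-n+1},q^2)}=0 .$$ (ii) There exist $c,\sigma>0$ such that, for $n$ big enough, $$|K_\nu(q^{-n},q^2)|<\sigma c^nq^{n^2}.$$
   Context: $\mathbb{R}_q^+=\{q^n:n\in\mathbb{Z}\}$; $(a;q)_n=\prod_{i=0}^{n-1}(1-aq^i)$ for $0\le n\le\infty$; $\int_0^\infty f(x)\,d_qx=(1-q)\sum_{n=-\infty}^\infty q^nf(q^n)$. The normalized $q$-Bessel function is $$j_\nu(x,q^2)=\sum_{n=0}^\infty(-1)^n\frac{q^{n(n+1)}}{(q^2;q^2)_n(q^{2\nu+2};q^2)_n}x^{2n}.$$ With $c_{q,\nu}=\frac{1}{1-q}\frac{(q^{2\nu+2};q^2)_\infty}{(q^2;q^2)_\infty}$, the $q$-Macdonald function is $$K_\nu(x,q^2)=c_{q,\nu}\int_0^\infty[1+t^2]^{-1}j_\nu(tx,q^2)t^{2\nu+1}d_qt,\qquad x\in\mathbb{R}_q^+.$$ *)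

theory Defs
  imports "HOL-Analysis.Analysis"
begin

definition qpoch :: "real \<Rightarrow> real \<Rightarrow> nat \<Rightarrow> real" where
  "qpoch a q n = (\<Prod>i<n. 1 - a * q ^ i)"

definition qpoch_inf :: "real \<Rightarrow> real \<Rightarrow> real" where
  "qpoch_inf a q = (\<Prod>i. 1 - a * q ^ i)"

text \<open>The Jackson integral from 0 to infinity. The bilateral series is read as an
  unconditional sum over the integers, which is 0 by convention if it does not converge.\<close>

definition jackson_integral :: "real \<Rightarrow> (real \<Rightarrow> real) \<Rightarrow> real" where
  "jackson_integral q f = (1 - q) * (\<Sum>\<^sub>\<infinity>n::int. q powi n * f (q powi n))"

text \<open>In the next two functions the parameter is \<open>q\<close>, not the base \<open>q\<^sup>2\<close>:
  \<open>q_bessel q \<nu> x\<close> is $j_\nu(x,q^2)$ and \<open>q_macdonald q \<nu> x\<close> is $K_\nu(x,q^2)$.\<close>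

definition q_bessel :: "real \<Rightarrow> real \<Rightarrow> real \<Rightarrow> real" where
  "q_bessel q \<nu> x =
     (\<Sum>n. (-1) ^ n * (q ^ (n * (n + 1)) /
        (qpoch (q\<^sup>2) (q\<^sup>2) n * qpoch (q powr (2 * \<nu> + 2)) (q\<^sup>2) n)) * x ^ (2 * n))"

definition q_bessel_const :: "real \<Rightarrow> real \<Rightarrow> real" where
  "q_bessel_const q \<nu> =
     1 / (1 - q) * (qpoch_inf (q powr (2 * \<nu> + 2)) (q\<^sup>2) / qpoch_inf (q\<^sup>2) (q\<^sup>2))"

text \<open>Only meaningful for \<open>x\<close> an integer power of \<open>q\<close>: elsewhere the integral
  need not converge.\<close>

definition q_macdonald :: "real \<Rightarrow> real \<Rightarrow> real \<Rightarrow> real" where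
  "q_macdonald q \<nu> x =
     q_bessel_const q \<nu> *
       jackson_integral q (\<lambda>t. inverse (1 + t\<^sup>2) * q_bessel q \<nu> (t * x) * t powr (2 * \<nu> + 1))"

end

theory Submission imports Defs begin

text \<open>
  Write \<open>p = q\<^sup>2\<close>, \<open>a = q\<^bsup>2\<nu>+2\<^esup>\<close>, \<open>b = a / p\<close>, and let \<open>J k\<close> be the
  q-Bessel function at \<open>q\<^bsup>k\<^esup>\<close> (\<open>bessel k\<close> below). Up to a positive constant factor, the q-Macdonald
  function at \<open>q\<^bsup>-n\<^esup>\<close> is \<open>y n\<close> (\<open>macdonald n\<close> below), the sum of \<open>a\<^bsup>m\<^esup> / (1 + p\<^bsup>m\<^esup>) * J (m - n)\<close> over all integers \<open>m\<close>.

  The power series of the q-Bessel function gives the three term recurrence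
  \<open>J (k - 1) - (1 + b) * J k + b * J (k + 1) = - p\<^bsup>k\<^esup> * J k\<close>. After multiplication by \<open>b\<^bsup>k\<^esup>\<close> its left
  side telescopes, so the sum of \<open>a\<^bsup>k\<^esup> * J k\<close> over the integers is zero
  (\<open>sum_a_bessel_eq_0\<close>). Summing the recurrence against the weights
  \<open>a\<^bsup>m\<^esup> / (1 + p\<^bsup>m\<^esup>)\<close> therefore leaves
  \<open>y (n + 1) = (1 + b + p\<^bsup>-n\<^esup>) * y n - b * y (n - 1)\<close> (\<open>macdonald_recurrence\<close>).

  A solution of this recurrence that at some index has a nonzero value, but has not decreased in
  absolute value or has not kept its sign in the last step, grows without bound from there on
  (\<open>minimal_solution_growth\<close>). Now \<open>y\<close> is bounded as
  \<open>n\<close> tends to infinity, so if \<open>y\<close> is not identically zero, it has one sign on all integers, and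
  the recurrence yields \<open>\<bar>y n\<bar> < b * p\<^bsup>n\<^esup> * \<bar>y (n - 1)\<bar>\<close>. This is the limit in (i), and
  iterating it from 0 gives (ii) with \<open>c = b * q\<close>.

  There remain two facts. All the sums need \<open>J k\<close> to decay faster than exponentially as \<open>k\<close> tends to
  minus infinity, which is invisible in the alternating power series; it follows from a
  symmetry between the argument and the parameter \<open>a\<close> of that series (\<open>phi_symmetry\<close>, \<open>bessel_neg_bound\<close>). And \<open>y\<close> does not
  vanish identically (\<open>macdonald_nontrivial\<close>): the bilateral generating function of \<open>y\<close> is a product
  of a positive sum and the generating function \<open>mellin u\<close>, the sum of \<open>u\<^bsup>k\<^esup> * J k\<close>. The latter
  blows up as \<open>u\<close> tends to 1, since \<open>J k\<close> tends to 1, and the functional equation that the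
  recurrence of \<open>J\<close> induces would propagate zeros from the strip where the product formula is
  valid up to that singularity.
\<close>

section \<open>Dominated double sums and sums over the integers\<close>

lemma choose_two_Suc: "Suc n choose 2 = (n choose 2) + n"
  by (simp add: numeral_2_eq_2)

lemma choose_two_add: "(j + n) choose 2 = (j choose 2) + (n choose 2) + j * n"
  by (induction j) (simp_all add: choose_two_Suc)

lemma summable_gaussian:
  fixes p r :: real
  assumes "0 < p" "p < 1" "0 \<le> r"
  shows "summable (\<lambda>n. p ^ (n choose 2) * r ^ n)"
proof -
  have "(\<lambda>n. p ^ n * r) \<longlonglongrightarrow> 0"
    using assms by (intro tendsto_mult_left_zero LIMSEQ_realpow_zero) auto
  then obtain N where N: "p ^ n * r < 1 / 2" if "n \<ge> N" for n
    by (metis (no_types, lifting) order_tendstoD(2) eventually_sequentially half_gt_zero_iff zero_less_one)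
  show ?thesis
  proof (rule summable_ratio_test[where c = "1 / 2" and N = N])
    fix n assume "n \<ge> N"
    have "norm (p ^ (Suc n choose 2) * r ^ Suc n) = (p ^ n * r) * (p ^ (n choose 2) * r ^ n)"
      using assms by (simp add: choose_two_Suc power_add)
    also have "\<dots> \<le> 1 / 2 * norm (p ^ (n choose 2) * r ^ n)"
      using mult_right_mono[of "p ^ n * r" "1 / 2" "p ^ (n choose 2) * r ^ n"] N[OF \<open>n \<ge> N\<close>] assms by simp
    finally show "norm (p ^ (Suc n choose 2) * r ^ Suc n) \<le> 1 / 2 * norm (p ^ (n choose 2) * r ^ n)" .
  qed simp
qed

lemma qpoch_ge_power:
  fixes x p :: real
  assumes "0 \<le> x" "x < 1" "0 \<le> p" "p \<le> 1"
  shows "(1 - x) ^ n \<le> qpoch x p n"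
proof -
  have "(\<Prod>i<n. 1 - x) \<le> (\<Prod>i<n. 1 - x * p ^ i)"
    using assms by (intro prod_mono) (auto simp: mult_left_le power_le_one)
  thus ?thesis by (simp add: qpoch_def)
qed

lemma qpoch_pos:
  fixes x p :: real
  assumes "0 \<le> x" "x < 1" "0 \<le> p" "p \<le> 1"
  shows "0 < qpoch x p n"
  using qpoch_ge_power[OF assms, of n] assms by (smt (verit) zero_less_power)

lemma qpoch_Suc: "qpoch x p (Suc n) = qpoch x p n * (1 - x * p ^ n)"
  by (simp add: qpoch_def)

lemma summable_on_product_dominated:
  fixes f :: "'a \<Rightarrow> 'b \<Rightarrow> real"
  assumes "g summable_on S" "h summable_on T"
    and "\<And>x y. x \<in> S \<Longrightarrow> y \<in> T \<Longrightarrow> \<bar>f x y\<bar> \<le> \<bar>g x\<bar> * \<bar>h y\<bar>"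
  shows "(\<lambda>(x, y). f x y) summable_on S \<times> T"
proof -
  have h: "(\<lambda>y. \<bar>h y\<bar>) summable_on T" and g: "(\<lambda>x. \<bar>g x\<bar>) summable_on S"
    using assms(1,2) summable_on_iff_abs_summable_on_real by (auto simp flip: real_norm_def)
  have "(\<lambda>z. norm (case z of (x, y) \<Rightarrow> \<bar>g x\<bar> * \<bar>h y\<bar>)) summable_on S \<times> T"
    unfolding Infinite_Sum.abs_summable_on_Sigma_iff
    using g h by (auto simp: abs_mult infsum_cmult_right' intro!: summable_on_cmult_right summable_on_cmult_left)
  hence "(\<lambda>z. norm (case z of (x, y) \<Rightarrow> f x y)) summable_on S \<times> T"
    by (rule Infinite_Sum.abs_summable_on_comparison_test) (auto simp: assms(3) abs_mult)
  thus ?thesis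
    using abs_summable_summable by blast
qed

lemma infsum_nat_eq_suminf:
  fixes f :: "nat \<Rightarrow> real"
  assumes "f summable_on UNIV"
  shows "infsum f UNIV = suminf f"
  using has_sum_imp_sums[OF has_sum_infsum[OF assms]] by (rule sums_unique)

lemma suminf_swap_dominated:
  fixes f :: "nat \<Rightarrow> nat \<Rightarrow> real"
  assumes g: "summable g" "\<And>n. 0 \<le> g n" and h: "summable h" "\<And>n. 0 \<le> h n"
    and le: "\<And>m n. \<bar>f m n\<bar> \<le> g m * h n"
  shows "(\<Sum>m. \<Sum>n. f m n) = (\<Sum>n. \<Sum>m. f m n)"
proof -
  have on: "g summable_on UNIV" "h summable_on UNIV"
    using g h by (auto intro: summable_nonneg_imp_summable_on)
  have s: "(\<lambda>(m, n). f m n) summable_on UNIV \<times> UNIV"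
    by (rule summable_on_product_dominated[OF on]) (use le g h in auto)
  have s': "(\<lambda>(n, m). f m n) summable_on UNIV \<times> UNIV"
    by (rule summable_on_product_dominated[OF on(2,1)]) (use le g h in \<open>auto simp: mult.commute\<close>)
  have 1: "f m summable_on UNIV" "(\<lambda>m. f m n) summable_on UNIV" for m n
    using summable_on_SigmaD1[OF s, of m] summable_on_SigmaD1[OF s', of n] by auto
  have 2: "(\<lambda>m. infsum (f m) UNIV) summable_on UNIV" "(\<lambda>n. infsum (\<lambda>m. f m n) UNIV) summable_on UNIV"
    using summable_on_Sigma_banach[OF s] summable_on_Sigma_banach[OF s'] by auto
  show ?thesis
    using infsum_swap_banach[OF s] 1 2 by (simp add: infsum_nat_eq_suminf)
qed

lemma summable_on_int_halves:
  fixes f :: "int \<Rightarrow> real"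
  assumes "summable (\<lambda>n. \<bar>f (int n)\<bar>)" "summable (\<lambda>n. \<bar>f (- int n)\<bar>)"
  shows "f summable_on UNIV"
proof -
  have "(f \<circ> int) summable_on UNIV" "(f \<circ> (\<lambda>n. - int n)) summable_on UNIV"
    using assms by (auto simp: o_def intro!: norm_summable_imp_summable_on)
  hence "f summable_on range int" "f summable_on range (\<lambda>n. - int n)"
    by (simp_all add: summable_on_reindex inj_on_def)
  hence "f summable_on range int \<union> range (\<lambda>n. - int n)"
    by (rule summable_on_union)
  also have "range int \<union> range (\<lambda>n. - int n) = UNIV"
    by (auto intro: int_cases2)
  finally show ?thesis .
qed

lemma infsum_int_shift:
  fixes f :: "int \<Rightarrow> real"
  shows "(\<Sum>\<^sub>\<infinity>k. f (k + c)) = (\<Sum>\<^sub>\<infinity>k. f k)"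
  by (rule infsum_reindex_bij_witness[where i = "\<lambda>k. k - c" and j = "\<lambda>k. k + c"]) auto

lemma summable_on_int_shift:
  fixes f :: "int \<Rightarrow> real"
  shows "(\<lambda>k. f (k + c)) summable_on UNIV \<longleftrightarrow> f summable_on UNIV"
  by (rule summable_on_reindex_bij_witness[where i = "\<lambda>k. k - c" and j = "\<lambda>k. k + c"]) auto

lemma has_sum_minus:
  fixes f g :: "'a \<Rightarrow> real"
  assumes "(f has_sum s) A" "(g has_sum t) A"
  shows "((\<lambda>x. f x - g x) has_sum (s - t)) A"
  using has_sum_add[OF assms(1) has_sum_uminusI[OF assms(2)]] by simp

section \<open>Minimal solutions of a second order recurrence\<close>

text \<open>Once the solution fails to decrease in absolute value, or changes sign, the term \<open>- b * y (n - 1)\<close>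
  can cancel at most \<open>b * \<bar>y n\<bar>\<close> of the leading term, so the next value is larger by the factor
  \<open>1 + p\<^bsup>-n\<^esup>\<close> at least. The hypothesis is then inherited by the next index, and the factors only
  improve as the index increases.\<close>

lemma minimal_solution_growth:
  fixes y :: "int \<Rightarrow> real"
  assumes b: "0 < b" and p: "0 < p" "p < 1"
    and rec: "\<And>n. y (n + 1) = (1 + b + p powi (- n)) * y n - b * y (n - 1)"
    and y0: "y n \<noteq> 0" and step: "\<bar>y (n - 1)\<bar> \<le> \<bar>y n\<bar> \<or> y (n - 1) * y n \<le> 0"
    and bounded: "\<And>k :: nat. \<bar>y (int k)\<bar> \<le> B"
  shows False
proof -
  define g where "g = 1 + p powi (- n)"
  have g: "1 < g" using p by (simp add: g_def)
  \<comment> \<open>The first value \<open>n\<close> supplies a factor \<open>g > 1\<close> that is valid for all later indices.\<close>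
  have grow: "g * \<bar>y m\<bar> \<le> \<bar>y (m + 1)\<bar>" 
    if "n \<le> m" "\<bar>y (m - 1)\<bar> \<le> \<bar>y m\<bar> \<or> y (m - 1) * y m \<le> 0" for m
  proof -
    define c where "c = 1 + b + p powi (- m)"
    have "p powi (- n) \<le> p powi (- m)"
      using p that by (intro power_int_decreasing) auto
    hence "g + b \<le> c" by (simp add: g_def c_def)
    have "c > 0" using b p by (simp add: c_def add_pos_pos)
    have "g * \<bar>y m\<bar> + b * \<bar>y m\<bar> \<le> c * \<bar>y m\<bar>"
      using mult_right_mono[OF \<open>g + b \<le> c\<close>, of "\<bar>y m\<bar>"] by (simp add: distrib_right)
    moreover have "c * \<bar>y m\<bar> - b * \<bar>y m\<bar> \<le> \<bar>y (m + 1)\<bar>"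
    proof (cases "\<bar>y (m - 1)\<bar> \<le> \<bar>y m\<bar>")
      case True
      have "\<bar>c * y m\<bar> \<le> \<bar>y (m + 1)\<bar> + \<bar>b * y (m - 1)\<bar>"
        using rec[of m] unfolding c_def[symmetric] by linarith
      moreover have "b * \<bar>y (m - 1)\<bar> \<le> b * \<bar>y m\<bar>"
        using True b by (intro mult_left_mono) auto
      moreover have "\<bar>c * y m\<bar> = c * \<bar>y m\<bar>" "\<bar>b * y (m - 1)\<bar> = b * \<bar>y (m - 1)\<bar>"
        using b \<open>c > 0\<close> by (simp_all add: abs_mult)
      ultimately show ?thesis by linarith
    next
      case False
      hence opp: "y (m - 1) * y m \<le> 0" using that by blast
      have "\<bar>c * y m\<bar> \<le> \<bar>y (m + 1)\<bar>"
      proof (cases "y m \<ge> 0")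
        case True
        hence "y m = 0 \<or> b * y (m - 1) \<le> 0" 
          using opp b by (auto simp: mult_le_0_iff)
        thus ?thesis using True \<open>c > 0\<close> rec[of m] unfolding c_def[symmetric] by auto
      next
        case False
        hence "0 \<le> b * y (m - 1)" "c * y m \<le> 0"
          using opp b \<open>c > 0\<close> by (auto simp: mult_le_0_iff)
        thus ?thesis using rec[of m] unfolding c_def[symmetric] by linarith
      qed
      moreover have "\<bar>c * y m\<bar> = c * \<bar>y m\<bar>" "0 \<le> b * \<bar>y m\<bar>"
        using b \<open>c > 0\<close> by (simp_all add: abs_mult)
      ultimately show ?thesis by linarith
    qed
    ultimately show ?thesis by linarith
  qed
  have "g ^ j * \<bar>y n\<bar> \<le> \<bar>y (n + int j)\<bar> \<and> 
      (\<bar>y (n + int j - 1)\<bar> \<le> \<bar>y (n + int j)\<bar> \<or> y (n + int j - 1) * y (n + int j) \<le> 0)" for j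
  proof (induction j)
    case 0
    thus ?case using step by simp
  next
    case (Suc j)
    have 1: "g * \<bar>y (n + int j)\<bar> \<le> \<bar>y (n + int j + 1)\<bar>"
      using Suc by (intro grow) auto
    have 2: "g * (g ^ j * \<bar>y n\<bar>) \<le> g * \<bar>y (n + int j)\<bar>"
      using Suc g by (intro mult_left_mono) auto
    have 3: "\<bar>y (n + int j)\<bar> \<le> g * \<bar>y (n + int j)\<bar>"
      using mult_right_mono[of 1 g "\<bar>y (n + int j)\<bar>"] g by simp
    show ?case using 1 2 3 by (simp add: add_ac mult_ac)
  qed
  hence lower: "g ^ j * \<bar>y n\<bar> \<le> \<bar>y (n + int j)\<bar>" for j by blast
  obtain j0 where j0: "B / \<bar>y n\<bar> < g ^ j0"
    using real_arch_pow[OF g] by blast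
  \<comment> \<open>The maximum with \<open>- n\<close> makes the index nonnegative, where the bound \<open>B\<close> applies.\<close>
  define j where "j = max j0 (nat (- n))"
  have "B / \<bar>y n\<bar> < g ^ j"
  proof -
    have "g ^ j0 \<le> g ^ j"
      using g by (intro power_increasing) (auto simp: j_def)
    thus ?thesis using j0 by linarith
  qed
  hence "B < \<bar>y (n + int j)\<bar>"
    using lower[of j] y0 by (simp add: field_simps)
  moreover have "n + int j = int (nat (n + int j))"
    by (simp add: j_def)
  ultimately show False
    using bounded[of "nat (n + int j)"] by simp
qed

text \<open>If \<open>y m = 0\<close>, then \<open>y (m + 1) = - b * y (m - 1)\<close>, and the step from \<open>m\<close> to \<open>m + 1\<close> is not decreasing.
  Boundedness forces both neighbours to vanish, so a zero spreads to all integers.\<close>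

lemma minimal_solution_nonzero:
  fixes y :: "int \<Rightarrow> real"
  assumes b: "0 < b" and p: "0 < p" "p < 1"
    and rec: "\<And>n. y (n + 1) = (1 + b + p powi (- n)) * y n - b * y (n - 1)"
    and bounded: "\<And>k :: nat. \<bar>y (int k)\<bar> \<le> B"
    and "y n0 \<noteq> 0"
  shows "y n \<noteq> 0"
proof
  assume "y n = 0"
  note growth = minimal_solution_growth[OF b p rec _ _ bounded]
  have prev: "y (m - 1) = 0" if "y m = 0" for m
    using growth[of "m + 1"] rec[of m] that b by auto
  have succ: "y (m + 1) = 0" if "y m = 0" for m
    using prev[OF that] rec[of m] that by simp
  have "y (n + int j) = 0 \<and> y (n - int j) = 0" for j
  proof (induction j)
    case (Suc j)
    thus ?case using succ[of "n + int j"] prev[of "n - int j"] by (simp add: algebra_simps)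
  qed (simp add: \<open>y n = 0\<close>)
  from this[of "nat (n0 - n)"] this[of "nat (n - n0)"] show False
    using \<open>y n0 \<noteq> 0\<close> by (cases "n \<le> n0") auto
qed

text \<open>The sign and the inequality \<open>\<bar>y (n + 1)\<bar> < \<bar>y n\<bar>\<close> are the negation of the hypothesis of
  \<open>minimal_solution_growth\<close>. Inserting the inequality into the recurrence, the term
  \<open>p\<^bsup>-n\<^esup> * y n\<close> must be balanced by \<open>b * y (n - 1)\<close> alone.\<close>

lemma minimal_solution_decay:
  fixes y :: "int \<Rightarrow> real"
  assumes b: "0 < b" and p: "0 < p" "p < 1"
    and rec: "\<And>n. y (n + 1) = (1 + b + p powi (- n)) * y n - b * y (n - 1)"
    and bounded: "\<And>k :: nat. \<bar>y (int k)\<bar> \<le> B"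
    and "y n0 \<noteq> 0"
  shows "0 < y (n - 1) * y n" and "\<bar>y n\<bar> < b * p powi n * \<bar>y (n - 1)\<bar>"
proof -
  note growth = minimal_solution_growth[OF b p rec _ _ bounded]
  note nz = minimal_solution_nonzero[OF b p rec bounded \<open>y n0 \<noteq> 0\<close>]
  show "0 < y (n - 1) * y n"
    using growth[of n] nz[of n] by force
  have "\<bar>y (n + 1)\<bar> < \<bar>y n\<bar>"
    using growth[of "n + 1"] nz[of "n + 1"] by force
  moreover have "(1 + b + p powi (- n)) * \<bar>y n\<bar> \<le> \<bar>y (n + 1)\<bar> + b * \<bar>y (n - 1)\<bar>"
  proof -
    have "\<bar>(1 + b + p powi (- n)) * y n\<bar> \<le> \<bar>y (n + 1)\<bar> + \<bar>b * y (n - 1)\<bar>"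
      using rec[of n] by linarith
    moreover have "0 < 1 + b + p powi (- n)"
      using b p by (simp add: add_pos_pos)
    ultimately show ?thesis using b by (simp add: abs_mult)
  qed
  moreover have "0 < b * \<bar>y n\<bar>"
    using b nz[of n] by simp
  ultimately have "p powi (- n) * \<bar>y n\<bar> < b * \<bar>y (n - 1)\<bar>"
    unfolding distrib_right mult_1 by linarith
  thus "\<bar>y n\<bar> < b * p powi n * \<bar>y (n - 1)\<bar>"
    using p by (simp add: power_int_minus field_simps)
qed

section \<open>Euler's series and the symmetry of the q-Bessel series\<close>

text \<open>The base \<open>p\<close> is \<open>q\<^sup>2\<close> and \<open>a\<close> is \<open>q\<^bsup>2\<nu>+2\<^esup>\<close>; the condition \<open>\<nu> > -1\<close> becomes \<open>a < 1\<close>.\<close>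

locale q_bessel_base =
  fixes p a :: real
  assumes p_pos: "0 < p" and p_less: "p < 1" and a_pos: "0 < a" and a_less: "a < 1"
begin

definition euler_coeff :: "nat \<Rightarrow> real" where
  "euler_coeff n = (-1) ^ n * p ^ (n choose 2) / qpoch p p n"

text \<open>By a theorem of Euler this series is the infinite product \<open>(w;p)\<^sub>\<infinity>\<close>. Only its functional equation,
  its zeros and its sign on the unit interval matter below, and these can be read off the series.\<close>

definition euler :: "real \<Rightarrow> real" where
  "euler w = (\<Sum>n. euler_coeff n * w ^ n)"

lemma qpoch_p_pos: "0 < qpoch p p n" and qpoch_a_pos: "0 < qpoch a p n"
  using p_pos p_less a_pos a_less by (auto intro!: qpoch_pos)

lemma euler_coeff_0 [simp]: "euler_coeff 0 = 1"
  by (simp add: euler_coeff_def qpoch_def numeral_2_eq_2)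

lemma euler_coeff_Suc: "euler_coeff (Suc n) * (1 - p ^ Suc n) = - (p ^ n * euler_coeff n)"
proof -
  have "1 - p ^ Suc n \<noteq> 0"
    using p_pos p_less power_Suc_less_one[of p n] by simp
  thus ?thesis
    using qpoch_p_pos[of n] qpoch_p_pos[of "Suc n"]
    by (simp add: euler_coeff_def qpoch_Suc choose_two_Suc power_add divide_simps)
qed

lemma abs_euler_coeff_le: "\<bar>euler_coeff n\<bar> \<le> p ^ (n choose 2) * (1 / (1 - p)) ^ n"
proof -
  have "p ^ (n choose 2) / qpoch p p n \<le> p ^ (n choose 2) / (1 - p) ^ n"
    using p_pos p_less qpoch_p_pos[of n] by (intro divide_left_mono qpoch_ge_power) auto
  thus ?thesis
    using qpoch_p_pos[of n] p_pos by (simp add: euler_coeff_def abs_mult power_divide)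
qed

lemma summable_abs_euler: "summable (\<lambda>n. \<bar>euler_coeff n * w ^ n\<bar>)"
proof (rule summable_comparison_test'[where N = 0])
  show "summable (\<lambda>n. p ^ (n choose 2) * (1 / (1 - p) * \<bar>w\<bar>) ^ n)"
    using p_pos p_less by (intro summable_gaussian) auto
  show "norm \<bar>euler_coeff n * w ^ n\<bar> \<le> p ^ (n choose 2) * (1 / (1 - p) * \<bar>w\<bar>) ^ n" for n
    using mult_right_mono[OF abs_euler_coeff_le, of "\<bar>w\<bar> ^ n" n]
    by (simp add: abs_mult power_abs power_mult_distrib power_divide)
qed

lemma summable_euler: "summable (\<lambda>n. euler_coeff n * w ^ n)"
  using summable_abs_euler by (rule summable_rabs_cancel)

lemma euler_functional: "euler w = (1 - w) * euler (w * p)"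
proof -
  have s: "summable (\<lambda>n. euler_coeff n * (1 - p ^ n) * w ^ n)"
    using summable_diff[OF summable_euler[of w] summable_euler[of "w * p"]]
    by (simp add: algebra_simps power_mult_distrib)
  have "euler w - euler (w * p) = (\<Sum>n. euler_coeff n * (1 - p ^ n) * w ^ n)"
    unfolding euler_def suminf_diff[OF summable_euler summable_euler]
    by (simp add: algebra_simps power_mult_distrib)
  also have "\<dots> = (\<Sum>n. euler_coeff (Suc n) * (1 - p ^ Suc n) * w ^ Suc n)"
    using suminf_split_head[OF s] by simp
  also have "\<dots> = (\<Sum>n. - w * (euler_coeff n * (w * p) ^ n))"
    by (simp only: euler_coeff_Suc) (simp add: power_mult_distrib mult_ac)
  also have "\<dots> = - w * euler (w * p)"
    unfolding euler_def by (rule suminf_mult[OF summable_euler])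
  finally show ?thesis by (simp add: algebra_simps)
qed

lemma euler_eq_qpoch_times: "euler w = qpoch w p n * euler (w * p ^ n)"
proof (induction n)
  case (Suc n)
  thus ?case
    using euler_functional[of "w * p ^ n"] by (simp add: qpoch_Suc mult_ac)
qed (simp add: qpoch_def)

lemma euler_root: "euler (p powi (- int j)) = 0"
proof (induction j)
  case 0
  show ?case using euler_functional[of 1] by simp
next
  case (Suc j)
  have "p powi (- int (Suc j)) * p = p powi (- int j)"
    using p_pos power_int_add_1[of p "- int (Suc j)"] by simp
  thus ?case using euler_functional[of "p powi (- int (Suc j))"] Suc by simp
qed

text \<open>Iterating the functional equation moves the argument to 0, where the series is 1, at the cost of
  positive factors.\<close>

lemma euler_pos: 
  assumes "0 \<le> w" "w < 1"
  shows "0 < euler w"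
proof -
  have "(\<lambda>n. w * p ^ n) \<longlonglongrightarrow> w * 0"
    using p_pos p_less by (intro tendsto_mult tendsto_const LIMSEQ_realpow_zero) auto
  moreover have "isCont euler 0"
    unfolding euler_def by (rule isCont_powser_converges_everywhere[OF summable_euler])
  ultimately have "(\<lambda>n. euler (w * p ^ n)) \<longlonglongrightarrow> euler 0"
    using isCont_tendsto_compose[of 0 euler] by fastforce
  moreover have "euler 0 = 1"
    by (simp add: euler_def)
  ultimately obtain n where "euler (w * p ^ n) > 0"
    by (metis order_tendstoD(1) eventually_happens' sequentially_bot zero_less_one)
  thus ?thesis
    unfolding euler_eq_qpoch_times[of w n]
    using assms p_pos p_less by (intro mult_pos_pos qpoch_pos) auto
qed

lemma abs_euler_le: 
  assumes "\<bar>w\<bar> \<le> 1"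
  shows "\<bar>euler w\<bar> \<le> (\<Sum>n. \<bar>euler_coeff n\<bar>)"
proof -
  have "\<bar>euler w\<bar> \<le> (\<Sum>n. \<bar>euler_coeff n * w ^ n\<bar>)"
    unfolding euler_def by (rule summable_rabs[OF summable_abs_euler])
  also have "\<dots> \<le> (\<Sum>n. \<bar>euler_coeff n\<bar>)"
    using summable_abs_euler[of 1] assms
    by (intro suminf_le summable_abs_euler) (auto simp: abs_mult power_abs intro!: mult_left_le power_le_one)
  finally show ?thesis .
qed

text \<open>This is the basic hypergeometric series \<open>\<^sub>1\<phi>\<^sub>1(0; a; p, z)\<close>.\<close>

definition phi :: "real \<Rightarrow> real" where
  "phi z = (\<Sum>n. euler_coeff n / qpoch a p n * z ^ n)"

lemma euler_a_pos: "0 < euler a"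
  using euler_pos a_pos a_less by simp

lemma phi_coeff: "euler_coeff n / qpoch a p n = euler_coeff n * euler (a * p ^ n) / euler a"
  using euler_eq_qpoch_times[of a n] qpoch_a_pos[of n] euler_a_pos
  by (metis mult_divide_mult_cancel_right mult_zero_right order_less_irrefl)

lemma summable_abs_phi: "summable (\<lambda>n. \<bar>euler_coeff n / qpoch a p n * z ^ n\<bar>)"
proof (rule summable_comparison_test'[where N = 0])
  show "summable (\<lambda>n. (\<Sum>n. \<bar>euler_coeff n\<bar>) / euler a * \<bar>euler_coeff n * z ^ n\<bar>)"
    by (intro summable_mult summable_abs_euler)
  show "norm \<bar>euler_coeff n / qpoch a p n * z ^ n\<bar>
      \<le> (\<Sum>n. \<bar>euler_coeff n\<bar>) / euler a * \<bar>euler_coeff n * z ^ n\<bar>" for n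
  proof -
    have "\<bar>a * p ^ n\<bar> \<le> 1"
      using p_pos p_less a_pos a_less by (simp add: abs_mult mult_le_one power_le_one)
    from mult_right_mono[OF abs_euler_le[OF this], of "\<bar>euler_coeff n * z ^ n\<bar>"]
    show ?thesis
      unfolding phi_coeff using euler_a_pos by (simp add: abs_mult field_simps)
  qed
qed

lemma summable_phi: "summable (\<lambda>n. euler_coeff n / qpoch a p n * z ^ n)"
  using summable_abs_phi by (rule summable_rabs_cancel)

text \<open>Since \<open>euler a / qpoch a p n = euler (a * p ^ n)\<close>, the left side is the double series with general
  term \<open>e\<^sub>n * e\<^sub>m * z\<^bsup>n\<^esup> * a\<^bsup>m\<^esup> * p\<^bsup>nm\<^esup>\<close>, where \<open>e\<^sub>n\<close> are the coefficients of Euler's series. This is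
  symmetric under exchanging \<open>z\<close> and \<open>a\<close>; the right side sums it in the other order.\<close>

lemma phi_symmetry: "euler a * phi z = (\<Sum>m. euler_coeff m * a ^ m * euler (z * p ^ m))"
proof -
  let ?f = "\<lambda>n m. euler_coeff n * z ^ n * (euler_coeff m * (a * p ^ n) ^ m)"
  have "euler a * phi z = (\<Sum>n. euler_coeff n * z ^ n * euler (a * p ^ n))"
    unfolding phi_def suminf_mult[OF summable_phi, symmetric]
    using euler_a_pos by (intro suminf_cong) (simp add: phi_coeff)
  also have "\<dots> = (\<Sum>n. \<Sum>m. ?f n m)"
    unfolding euler_def by (simp add: suminf_mult[OF summable_euler])
  also have "\<dots> = (\<Sum>m. \<Sum>n. ?f n m)"
  proof (rule suminf_swap_dominated[OF summable_abs_euler[of z] _ summable_abs_euler[of a]])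
    fix n m
    have "\<bar>?f n m\<bar> = \<bar>euler_coeff n * z ^ n\<bar> * \<bar>euler_coeff m * a ^ m\<bar> * (p ^ n) ^ m"
      using p_pos by (simp add: abs_mult power_mult_distrib mult_ac)
    also have "\<dots> \<le> \<bar>euler_coeff n * z ^ n\<bar> * \<bar>euler_coeff m * a ^ m\<bar>"
      using p_pos p_less by (intro mult_left_le power_le_one) auto
    finally show "\<bar>?f n m\<bar> \<le> \<bar>euler_coeff n * z ^ n\<bar> * \<bar>euler_coeff m * a ^ m\<bar>" .
  qed auto
  also have "\<dots> = (\<Sum>m. euler_coeff m * a ^ m * euler (z * p ^ m))"
  proof (rule suminf_cong)
    fix m
    have "?f n m = euler_coeff m * a ^ m * (euler_coeff n * (z * p ^ m) ^ n)" for n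
      by (simp add: power_mult_distrib mult_ac flip: power_mult)
    thus "(\<Sum>n. ?f n m) = euler_coeff m * a ^ m * euler (z * p ^ m)"
      unfolding euler_def by (simp only: suminf_mult[OF summable_euler])
  qed
  finally show ?thesis .
qed

text \<open>The coefficient of \<open>w\<^bsup>n\<^esup>\<close> on the left carries the factor
  \<open>1 - (1 + a / p) * p\<^bsup>n\<^esup> + (a / p) * p\<^bsup>2n\<^esup> = (1 - p\<^bsup>n\<^esup>) * (1 - a * p\<^bsup>n-1\<^esup>)\<close>, which is
  what separates consecutive coefficients of the series.\<close>

lemma phi_recurrence:
  "phi w - (1 + a / p) * phi (w * p) + a / p * phi (w * p * p) = - w * phi (w * p)"
proof -
  define c where "c n = euler_coeff n / qpoch a p n" for n
  note s = summable_phi[folded c_def]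
  have c_Suc: "c (Suc n) * ((1 - p ^ Suc n) * (1 - a * p ^ n)) = - (p ^ n * c n)" for n
  proof -
    have "1 - a * p ^ n \<noteq> 0"
      using qpoch_a_pos[of "Suc n"] by (auto simp: qpoch_Suc)
    hence "c (Suc n) * ((1 - p ^ Suc n) * (1 - a * p ^ n))
         = euler_coeff (Suc n) * (1 - p ^ Suc n) / qpoch a p n"
      by (simp add: c_def qpoch_Suc)
    thus ?thesis
      unfolding euler_coeff_Suc by (simp add: c_def)
  qed
  define b where "b = a / p"
  let ?f = "\<lambda>n. c n * w ^ n - (1 + b) * (c n * (w * p) ^ n) + b * (c n * (w * p * p) ^ n)"
  have sf: "summable ?f"
    by (intro summable_add summable_diff summable_mult s)
  have "phi w - (1 + a / p) * phi (w * p) + a / p * phi (w * p * p) = suminf ?f"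
    unfolding phi_def c_def[symmetric] b_def[symmetric]
    by (simp add: suminf_add[symmetric] suminf_diff[symmetric] suminf_mult s summable_mult summable_diff)
  also have "\<dots> = (\<Sum>n. ?f (Suc n))"
    using suminf_split_head[OF sf] by (simp add: algebra_simps)
  also have "\<dots> = (\<Sum>n. - w * (c n * (w * p) ^ n))"
  proof (rule suminf_cong)
    fix n
    have "?f (Suc n) = c (Suc n) * ((1 - p ^ Suc n) * (1 - a * p ^ n)) * w ^ Suc n"
      using p_pos by (simp add: b_def power_mult_distrib field_simps)
    thus "?f (Suc n) = - w * (c n * (w * p) ^ n)"
      by (simp only: c_Suc) (simp add: power_mult_distrib)
  qed
  also have "\<dots> = - w * phi (w * p)"
    unfolding phi_def c_def[symmetric] by (rule suminf_mult[OF s])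
  finally show ?thesis .
qed

lemma phi_near_0:
  assumes "\<bar>z\<bar> \<le> 1"
  shows "\<bar>phi z - 1\<bar> \<le> (\<Sum>n. \<bar>euler_coeff n / qpoch a p n\<bar>) * \<bar>z\<bar>"
proof -
  define c where "c n = euler_coeff n / qpoch a p n" for n
  note s = summable_phi[folded c_def] and sa = summable_abs_phi[folded c_def]
  have s1: "summable (\<lambda>n. \<bar>c n\<bar>)"
    using sa[of 1] by simp
  have s2: "summable (\<lambda>n. \<bar>c (Suc n) * z ^ Suc n\<bar>)"
    using sa[of z] by (subst summable_Suc_iff)
  have "phi z - 1 = (\<Sum>n. c (Suc n) * z ^ Suc n)"
    using suminf_split_head[OF s[of z]] by (simp add: phi_def c_def qpoch_def)
  also have "\<bar>\<dots>\<bar> \<le> (\<Sum>n. \<bar>c (Suc n) * z ^ Suc n\<bar>)"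
    by (rule summable_rabs[OF s2])
  also have "\<dots> \<le> (\<Sum>n. \<bar>c (Suc n)\<bar> * \<bar>z\<bar>)"
  proof (intro suminf_le s2)
    show "summable (\<lambda>n. \<bar>c (Suc n)\<bar> * \<bar>z\<bar>)"
      using s1 by (intro summable_mult2) (subst summable_Suc_iff)
    show "\<bar>c (Suc n) * z ^ Suc n\<bar> \<le> \<bar>c (Suc n)\<bar> * \<bar>z\<bar>" for n
      using assms by (simp add: abs_mult power_abs mult_left_le power_le_one mult_left_mono)
  qed
  also have "\<dots> = (\<Sum>n. \<bar>c (Suc n)\<bar>) * \<bar>z\<bar>"
    using s1 by (intro suminf_mult2[symmetric]) (subst summable_Suc_iff)
  also have "\<dots> \<le> (\<Sum>n. \<bar>c n\<bar>) * \<bar>z\<bar>"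
    using suminf_split_head[OF s1] by (intro mult_right_mono) auto
  finally show ?thesis by (simp add: c_def)
qed

section \<open>The q-Bessel function on the powers of q\<close>

text \<open>The value of the q-Bessel function at \<open>q\<^bsup>k\<^esup>\<close>. The shift by 1 turns the exponent \<open>n * (n + 1)\<close> of
  \<open>q\<close> in the q-Bessel series into \<open>n * (n - 1)\<close>, the exponent in Euler's coefficients.\<close>

definition bessel :: "int \<Rightarrow> real" where
  "bessel k = phi (p powi (k + 1))"

lemma bessel_recurrence: "bessel (k - 1) - (1 + a / p) * bessel k + a / p * bessel (k + 1) = - (p powi k) * bessel k"
  using phi_recurrence[of "p powi k"] p_pos
  by (simp add: bessel_def power_int_add_1 add.commute[of _ 2] flip: power_int_add_1)

lemma bessel_nonneg_bound: "\<exists>M. \<forall>n. \<bar>bessel (int n) - 1\<bar> \<le> M * p ^ n"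
proof (intro exI allI)
  fix n
  let ?M = "\<Sum>n. \<bar>euler_coeff n / qpoch a p n\<bar>"
  have "\<bar>p powi (int n + 1)\<bar> \<le> 1"
    using p_pos p_less by (simp add: power_int_le_one)
  from phi_near_0[OF this] have "\<bar>bessel (int n) - 1\<bar> \<le> ?M * p powi (int n + 1)"
    using p_pos by (simp add: bessel_def)
  also have "\<dots> \<le> ?M * p ^ n"
    using p_pos p_less summable_abs_phi[of 1]
    by (intro mult_left_mono suminf_nonneg) (auto simp: power_int_add_1)
  finally show "\<bar>bessel (int n) - 1\<bar> \<le> ?M * p ^ n" .
qed

text \<open>In the symmetric form the argument of Euler's series is \<open>p\<^bsup>m+1-n\<^esup>\<close>, which is one of its zeros for
  \<open>m < n\<close>. The series therefore starts at \<open>m = n\<close> with a term of order \<open>p\<^bsup>n(n-1)/2\<^esup>\<close>.\<close>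

lemma bessel_neg_bound: "\<exists>M. \<forall>n. \<bar>bessel (- int n)\<bar> \<le> M * (p ^ (n choose 2) * (a / (1 - p)) ^ n)"
proof (intro exI allI)
  fix n
  define A where "A = a / (1 - p)"
  define E where "E = (\<Sum>n. \<bar>euler_coeff n\<bar>)"
  have A: "0 \<le> A" using a_pos p_less by (simp add: A_def)
  have E: "0 \<le> E"
    unfolding E_def using summable_abs_euler[of 1] by (intro suminf_nonneg) auto
  define t where "t m = euler_coeff m * a ^ m * euler (p powi (- int n + 1) * p ^ m)" for m
  have arg: "p powi (- int n + 1) * p ^ m = p powi (int m + 1 - int n)" for m
    using p_pos by (simp add: algebra_simps flip: power_int_add power_int_of_nat)
  have t_0: "t m = 0" if "m < n" for m
  proof -
    have "int m + 1 - int n = - int (n - m - 1)"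
      using that by simp
    thus ?thesis
      by (simp only: t_def arg euler_root mult_zero_right)
  qed
  have t_bound: "\<bar>t (j + n)\<bar> \<le> p ^ (n choose 2) * A ^ n * E * (p ^ (j choose 2) * A ^ j)" for j
  proof -
    have "\<bar>p powi (int (j + n) + 1 - int n)\<bar> \<le> 1"
      using p_pos p_less by (simp add: power_int_le_one)
    from abs_euler_le[OF this]
    have "\<bar>t (j + n)\<bar> \<le> p ^ ((j + n) choose 2) * (1 / (1 - p)) ^ (j + n) * a ^ (j + n) * E"
      unfolding t_def arg abs_mult E_def
      using a_pos by (intro mult_mono abs_euler_coeff_le) (use p_pos p_less in auto)
    also have "\<dots> = p ^ (j * n) * (p ^ (n choose 2) * A ^ n * E * (p ^ (j choose 2) * A ^ j))"
      by (simp add: A_def choose_two_add power_add power_divide mult_ac)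
    also have "\<dots> \<le> p ^ (n choose 2) * A ^ n * E * (p ^ (j choose 2) * A ^ j)"
      using p_pos p_less A E by (intro mult_left_le_one_le) (auto simp: power_le_one)
    finally show ?thesis .
  qed
  have sg: "summable (\<lambda>j. p ^ (j choose 2) * A ^ j)"
    using p_pos p_less A by (rule summable_gaussian)
  have st': "summable (\<lambda>j. \<bar>t (j + n)\<bar>)"
    by (rule summable_comparison_test'[OF summable_mult[OF sg], where N = 0]) (use t_bound in auto)
  hence st: "summable t"
    by (rule iffD1[OF summable_iff_shift summable_rabs_cancel])
  have "euler a * bessel (- int n) = suminf t"
    unfolding bessel_def phi_symmetry t_def[abs_def] ..
  also have "\<dots> = (\<Sum>j. t (j + n))"
    using suminf_split_initial_segment[OF st, of n] t_0 by simp
  finally have "euler a * \<bar>bessel (- int n)\<bar> = \<bar>\<Sum>j. t (j + n)\<bar>"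
    using euler_a_pos by (metis abs_mult abs_of_pos)
  also have "\<dots> \<le> (\<Sum>j. \<bar>t (j + n)\<bar>)"
    by (rule summable_rabs[OF st'])
  also have "\<dots> \<le> (\<Sum>j. p ^ (n choose 2) * A ^ n * E * (p ^ (j choose 2) * A ^ j))"
    by (intro suminf_le t_bound st' summable_mult sg)
  also have "\<dots> = p ^ (n choose 2) * A ^ n * E * (\<Sum>j. p ^ (j choose 2) * A ^ j)"
    by (rule suminf_mult[OF sg])
  finally have "\<bar>bessel (- int n)\<bar> * euler a \<le> p ^ (n choose 2) * A ^ n * E * (\<Sum>j. p ^ (j choose 2) * A ^ j)"
    by (simp only: mult.commute)
  hence "\<bar>bessel (- int n)\<bar> \<le> p ^ (n choose 2) * A ^ n * E * (\<Sum>j. p ^ (j choose 2) * A ^ j) / euler a"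
    by (simp only: pos_le_divide_eq[OF euler_a_pos])
  thus "\<bar>bessel (- int n)\<bar> \<le> (E * (\<Sum>j. p ^ (j choose 2) * A ^ j) / euler a) *
      (p ^ (n choose 2) * (a / (1 - p)) ^ n)"
    unfolding A_def[symmetric] by (simp add: mult_ac)
qed

lemma summable_bessel_neg:
  assumes "0 \<le> r"
  shows "summable (\<lambda>n. r ^ n * \<bar>bessel (- int n)\<bar>)"
proof -
  define A where "A = a / (1 - p)"
  have A: "0 \<le> A" using a_pos p_less by (simp add: A_def)
  obtain M where M: "\<bar>bessel (- int n)\<bar> \<le> M * (p ^ (n choose 2) * A ^ n)" for n
    using bessel_neg_bound unfolding A_def by blast
  show ?thesis
  proof (rule summable_comparison_test'[where N = 0])
    show "summable (\<lambda>n. M * (p ^ (n choose 2) * (r * A) ^ n))"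
      using p_pos p_less A assms by (intro summable_mult summable_gaussian) auto
    show "norm (r ^ n * \<bar>bessel (- int n)\<bar>) \<le> M * (p ^ (n choose 2) * (r * A) ^ n)" for n
      using mult_left_mono[OF M[of n], of "r ^ n"] assms
      by (simp add: abs_mult power_mult_distrib mult_ac)
  qed
qed

lemma summable_bessel:
  assumes "0 < u" "u < 1"
  shows "(\<lambda>k. u powi k * bessel k) summable_on UNIV"
proof (rule summable_on_int_halves)
  obtain M where M: "\<bar>bessel (int n) - 1\<bar> \<le> M * p ^ n" for n
    using bessel_nonneg_bound by blast
  show "summable (\<lambda>n. \<bar>u powi int n * bessel (int n)\<bar>)"
  proof (rule summable_comparison_test'[where N = 0])
    show "summable (\<lambda>n. M * (u * p) ^ n + u ^ n)"
      using assms p_pos p_less mult_strict_mono[of u 1 p 1]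
      by (intro summable_add summable_mult summable_geometric) (auto simp: abs_mult)
    show "norm \<bar>u powi int n * bessel (int n)\<bar> \<le> M * (u * p) ^ n + u ^ n" for n
    proof -
      have "\<bar>bessel (int n)\<bar> \<le> M * p ^ n + 1"
        using M[of n] by linarith
      from mult_left_mono[OF this, of "u ^ n"] show ?thesis
        using assms by (simp add: abs_mult power_mult_distrib algebra_simps)
    qed
  qed
  show "summable (\<lambda>n. \<bar>u powi (- int n) * bessel (- int n)\<bar>)"
    using summable_bessel_neg[of "inverse u"] assms by (simp add: abs_mult power_int_minus power_inverse)
qed

text \<open>The recurrence, multiplied by \<open>b\<^bsup>m\<^esup>\<close> with \<open>b = a / p\<close>, expresses \<open>a\<^bsup>m\<^esup> * bessel m\<close> as a difference of
  consecutive values of the sequence \<open>b * h\<close> below. This sequence is summable in both directions, so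
  the two shifted sums cancel; at plus infinity it matters that \<open>h\<close> contains a difference of
  q-Bessel values, of order \<open>p\<^bsup>m\<^esup>\<close>, because \<open>b\<close> itself may exceed 1.\<close>

lemma sum_a_bessel_eq_0: "(\<Sum>\<^sub>\<infinity>m. a powi m * bessel m) = 0"
proof -
  define b where "b = a / p"
  have b: "0 < b" "b * p = a" using a_pos p_pos by (auto simp: b_def)
  define h where "h m = b powi m * (bessel (m + 1) - bessel m)" for m
  obtain M where M: "\<bar>bessel (int n) - 1\<bar> \<le> M * p ^ n" for n
    using bessel_nonneg_bound by blast
  have "h summable_on UNIV"
  proof (rule summable_on_int_halves)
    show "summable (\<lambda>n. \<bar>h (int n)\<bar>)"
    proof (rule summable_comparison_test'[where N = 0])
      show "summable (\<lambda>n. M * (1 + p) * a ^ n)"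
        using a_pos a_less by (intro summable_mult summable_geometric) auto
      show "norm \<bar>h (int n)\<bar> \<le> M * (1 + p) * a ^ n" for n
      proof -
        have "\<bar>bessel (int n + 1) - bessel (int n)\<bar> \<le> M * (1 + p) * p ^ n"
          using M[of n] M[of "Suc n"] by (simp add: algebra_simps)
        from mult_left_mono[OF this, of "b ^ n"] show ?thesis
          using b by (simp add: h_def abs_mult mult_ac flip: power_mult_distrib)
      qed
    qed
    have "summable (\<lambda>n. inverse b ^ n * \<bar>bessel (1 - int n)\<bar>)"
    proof -
      have "summable (\<lambda>n. inverse b ^ Suc n * \<bar>bessel (1 - int (Suc n))\<bar>)"
        using summable_mult[OF summable_bessel_neg[of "inverse b"], of "inverse b"] b
        by (simp add: mult_ac)
      thus ?thesis by (subst (asm) summable_Suc_iff)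
    qed
    hence "summable (\<lambda>n. inverse b ^ n * \<bar>bessel (1 - int n)\<bar> + inverse b ^ n * \<bar>bessel (- int n)\<bar>)"
      using b by (intro summable_add summable_bessel_neg) auto
    thus "summable (\<lambda>n. \<bar>h (- int n)\<bar>)"
    proof (rule summable_comparison_test'[where N = 0])
      show "norm \<bar>h (- int n)\<bar> \<le> inverse b ^ n * \<bar>bessel (1 - int n)\<bar> + inverse b ^ n * \<bar>bessel (- int n)\<bar>" for n
        using b by (simp add: h_def abs_mult power_int_minus power_inverse
            flip: distrib_left)
    qed
  qed
  hence bh: "(\<lambda>m. b * h m) summable_on UNIV"
    by (rule summable_on_cmult_right)
  hence bh': "(\<lambda>m. b * h (m + - 1)) summable_on UNIV"
    by (rule iffD2[OF summable_on_int_shift])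
  have "a powi m * bessel m = b * h (m + - 1) - b * h m" for m
  proof -
    have "a powi m * bessel m = b powi m * (p powi m * bessel m)"
      unfolding b(2)[symmetric] by (simp add: power_int_mult_distrib)
    also have "p powi m * bessel m = (bessel m - bessel (m - 1)) - b * (bessel (m + 1) - bessel m)"
      using bessel_recurrence[of m] by (simp add: b_def algebra_simps)
    finally have "a powi m * bessel m = b powi m * (bessel m - bessel (m - 1) - b * (bessel (m + 1) - bessel m))" .
    moreover have "b * h (m + - 1) = b powi m * (bessel m - bessel (m - 1))"
    proof -
      have "b * b powi (m - 1) = b powi m"
        using power_int_minus_mult[of b m] b(1) by (simp add: mult.commute)
      thus ?thesis by (simp add: h_def mult.assoc[symmetric])
    qed
    ultimately show ?thesis
      by (simp add: h_def[of m] algebra_simps)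
  qed
  hence "(\<Sum>\<^sub>\<infinity>m. a powi m * bessel m) = (\<Sum>\<^sub>\<infinity>m. b * h (m + - 1) - b * h m)"
    by (rule infsum_cong)
  also have "\<dots> = (\<Sum>\<^sub>\<infinity>m. b * h (m + - 1)) - (\<Sum>\<^sub>\<infinity>m. b * h m)"
    by (intro infsumI has_sum_minus has_sum_infsum bh bh')
  also have "\<dots> = 0"
    using infsum_int_shift[of "\<lambda>m. b * h m" "- 1"] by simp
  finally show ?thesis .
qed

section \<open>The recurrence of the q-Macdonald function\<close>

definition weight :: "int \<Rightarrow> real" where
  "weight m = a powi m / (1 + p powi m)"

text \<open>The value of the q-Macdonald function at \<open>q\<^bsup>-n\<^esup>\<close> without its constant factor.\<close>

definition macdonald :: "int \<Rightarrow> real" where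
  "macdonald n = (\<Sum>\<^sub>\<infinity>m. weight m * bessel (m - n))"

lemma weight_pos: "0 < weight m"
  using a_pos p_pos by (simp add: weight_def add_pos_pos)

lemma weight_le: "weight m \<le> a powi m"
  using a_pos p_pos by (simp add: weight_def divide_le_eq add_pos_pos algebra_simps)

lemma weight_times: "weight m * p powi m = a powi m - weight m"
proof -
  have "1 + p powi m \<noteq> 0" using p_pos by (smt (verit) zero_less_power_int)
  thus ?thesis by (simp add: weight_def field_simps)
qed

lemma has_sum_shifted_bessel:
  assumes "0 < u" "u < 1"
  shows "((\<lambda>m. u powi m * bessel (m - n)) has_sum u powi n * (\<Sum>\<^sub>\<infinity>k. u powi k * bessel k)) UNIV"
proof -
  have "((\<lambda>k. u powi n * (u powi k * bessel k)) has_sum u powi n * (\<Sum>\<^sub>\<infinity>k. u powi k * bessel k)) UNIV"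
    by (intro has_sum_cmult_right has_sum_infsum summable_bessel assms)
  thus ?thesis
    by (rule iffD1[OF has_sum_reindex_bij_witness[where i = "\<lambda>m. m - n" and j = "\<lambda>k. k + n"], rotated -1])
      (use assms in \<open>auto simp: power_int_add\<close>)
qed

lemma summable_weight_bessel: "(\<lambda>m. weight m * bessel (m - n)) summable_on UNIV"
proof -
  have "(\<lambda>m. a powi m * bessel (m - n)) summable_on UNIV"
    using has_sum_shifted_bessel[OF a_pos a_less] by (auto simp: has_sum_iff)
  hence "(\<lambda>m. \<bar>a powi m * bessel (m - n)\<bar>) summable_on UNIV"
    using summable_on_iff_abs_summable_on_real by force
  hence "(\<lambda>m. norm (weight m * bessel (m - n))) summable_on UNIV"
    by (rule Infinite_Sum.abs_summable_on_comparison_test')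
      (use weight_le weight_pos a_pos in \<open>auto simp: abs_mult less_imp_le intro!: mult_right_mono\<close>)
  thus ?thesis by (rule abs_summable_summable)
qed

text \<open>Applying the recurrence of \<open>bessel\<close> under the sum multiplies the weight by
  \<open>- p\<^bsup>-n\<^esup> * p\<^bsup>m\<^esup>\<close>, and \<open>weight m * p\<^bsup>m\<^esup> = a\<^bsup>m\<^esup> - weight m\<close>. The part with \<open>a\<^bsup>m\<^esup>\<close> sums to zero.\<close>

lemma macdonald_recurrence: "macdonald (n + 1) = (1 + a / p + p powi (- n)) * macdonald n - a / p * macdonald (n - 1)"
proof -
  have s: "((\<lambda>m. weight m * bessel (m - n)) has_sum macdonald n) UNIV" for n
    unfolding macdonald_def by (intro has_sum_infsum summable_weight_bessel)
  have 0: "((\<lambda>m. a powi m * bessel (m - n)) has_sum 0) UNIV"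
    using has_sum_shifted_bessel[OF a_pos a_less, of n] sum_a_bessel_eq_0 by simp
  have "((\<lambda>m. weight m * bessel (m - (n + 1)) - (1 + a / p) * (weight m * bessel (m - n)) 
      + a / p * (weight m * bessel (m - (n - 1)))) has_sum
      (macdonald (n + 1) - (1 + a / p) * macdonald n + a / p * macdonald (n - 1))) UNIV"
    by (intro has_sum_add has_sum_minus has_sum_cmult_right s)
  moreover have "((\<lambda>m. p powi (- n) * (weight m * bessel (m - n) - a powi m * bessel (m - n))) has_sum 
      p powi (- n) * (macdonald n - 0)) UNIV"
    by (intro has_sum_cmult_right has_sum_minus s 0)
  moreover have "weight m * bessel (m - (n + 1)) - (1 + a / p) * (weight m * bessel (m - n)) 
      + a / p * (weight m * bessel (m - (n - 1)))
      = p powi (- n) * (weight m * bessel (m - n) - a powi m * bessel (m - n))" (is "?l = _") for m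
  proof -
    have "?l = weight m * (bessel (m - n - 1) - (1 + a / p) * bessel (m - n) + a / p * bessel (m - n + 1))"
      by (simp add: algebra_simps)
    also have "\<dots> = - (p powi (- n)) * (weight m * p powi m) * bessel (m - n)"
      unfolding bessel_recurrence using p_pos by (simp add: power_int_diff power_int_minus divide_inverse)
    finally show ?thesis
      unfolding weight_times by (simp add: algebra_simps)
  qed
  ultimately have "macdonald (n + 1) - (1 + a / p) * macdonald n + a / p * macdonald (n - 1) = p powi (- n) * macdonald n"
    by (simp only: diff_0_right) (rule has_sum_unique)
  thus ?thesis by (simp add: algebra_simps)
qed

lemma macdonald_bounded: "\<exists>B. \<forall>n. \<bar>macdonald (int n)\<bar> \<le> B"
proof (intro exI allI)
  fix n
  let ?B = "\<Sum>\<^sub>\<infinity>k. \<bar>a powi k * bessel k\<bar>"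
  have s: "(\<lambda>k. \<bar>a powi k * bessel k\<bar>) summable_on UNIV"
    using summable_bessel[OF a_pos a_less] summable_on_iff_abs_summable_on_real by force
  have s': "(\<lambda>m. \<bar>a powi (m + - int n) * bessel (m + - int n)\<bar>) summable_on UNIV"
    using s by (subst summable_on_int_shift[of "\<lambda>k. \<bar>a powi k * bessel k\<bar>"])
  have w: "(\<lambda>m. \<bar>weight m * bessel (m - int n)\<bar>) summable_on UNIV"
    using summable_weight_bessel[of "int n"] summable_on_iff_abs_summable_on_real by force
  have "\<bar>macdonald (int n)\<bar> \<le> (\<Sum>\<^sub>\<infinity>m. \<bar>weight m * bessel (m - int n)\<bar>)"
    unfolding macdonald_def using norm_infsum_bound[of "\<lambda>m. weight m * bessel (m - int n)" UNIV] w by simp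
  also have "\<dots> \<le> (\<Sum>\<^sub>\<infinity>m. \<bar>a powi (m + - int n) * bessel (m + - int n)\<bar>)"
  proof (rule infsum_mono[OF w s'])
    fix m
    have "weight m \<le> a powi m" by (rule weight_le)
    also have "\<dots> \<le> a powi (m + - int n)"
      using a_pos a_less by (intro power_int_decreasing) auto
    finally show "\<bar>weight m * bessel (m - int n)\<bar> \<le> \<bar>a powi (m + - int n) * bessel (m + - int n)\<bar>"
      using weight_pos[of m] a_pos by (simp add: abs_mult mult_right_mono)
  qed
  also have "\<dots> = ?B"
    by (rule infsum_int_shift[of "\<lambda>k. \<bar>a powi k * bessel k\<bar>"])
  finally show "\<bar>macdonald (int n)\<bar> \<le> ?B" .
qed

section \<open>The q-Macdonald function is not identically zero\<close>

text \<open>A discrete Mellin transform of the q-Bessel function. The sum converges for \<open>0 < u < 1\<close>.\<close>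

definition mellin :: "real \<Rightarrow> real" where
  "mellin u = (\<Sum>\<^sub>\<infinity>k. u powi k * bessel k)"

lemma has_sum_mellin: "0 < u \<Longrightarrow> u < 1 \<Longrightarrow> ((\<lambda>k. u powi k * bessel k) has_sum mellin u) UNIV"
  unfolding mellin_def by (intro has_sum_infsum summable_bessel)

lemma mellin_functional:
  assumes "0 < u" "u < 1"
  shows "u * mellin (u * p) = (1 - u) * (u - a / p) * mellin u"
proof -
  have up: "0 < u * p" "u * p < 1"
    using assms p_pos p_less mult_strict_mono[of u 1 p 1] by auto
  have sh: "((\<lambda>k. u powi k * bessel (k - n)) has_sum u powi n * mellin u) UNIV" for n
    using has_sum_shifted_bessel[OF assms] by (simp add: mellin_def)
  have "((\<lambda>k. - (u powi k * bessel (k - 1) - (1 + a / p) * (u powi k * bessel (k - 0)) 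
      + a / p * (u powi k * bessel (k - (-1))))) has_sum
      - (u powi 1 * mellin u - (1 + a / p) * (u powi 0 * mellin u) + a / p * (u powi (-1) * mellin u))) UNIV"
    by (intro has_sum_uminusI has_sum_add has_sum_minus has_sum_cmult_right sh)
  moreover have "- (u powi k * bessel (k - 1) - (1 + a / p) * (u powi k * bessel (k - 0)) 
      + a / p * (u powi k * bessel (k - (-1)))) = (u * p) powi k * bessel k" for k
    using arg_cong[OF bessel_recurrence[of k], of "\<lambda>x. - (u powi k * x)"]
    by (simp add: power_int_mult_distrib algebra_simps)
  ultimately have "mellin (u * p) = - (u * mellin u - (1 + a / p) * mellin u + a / p * (inverse u * mellin u))"
    using has_sum_mellin[OF up] by (simp add: has_sum_unique power_int_minus)
  thus ?thesis
    using assms p_pos by (simp add: field_simps)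
qed

text \<open>Since \<open>bessel k\<close> tends to 1 geometrically as \<open>k\<close> tends to infinity, \<open>mellin u\<close> differs from
  \<open>1 / (1 - u)\<close>, the sum of \<open>u\<^bsup>k\<^esup>\<close> over \<open>k \<ge> 0\<close>, by an amount that stays bounded for \<open>1/2 < u < 1\<close>.\<close>

lemma mellin_pos_near_1: "\<exists>u0<1. \<forall>u. u0 < u \<and> u < 1 \<longrightarrow> 0 < mellin u"
proof -
  define r where "r k = bessel k - (if k \<ge> 0 then 1 else 0)" for k
  define g where "g k = \<bar>(if k \<ge> 0 then 1 else (1/2) powi k) * r k\<bar>" for k
  define B where "B = infsum g UNIV"
  obtain M where M: "\<bar>bessel (int n) - 1\<bar> \<le> M * p ^ n" for n
    using bessel_nonneg_bound by blast
  have g: "g summable_on UNIV"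
  proof (rule summable_on_int_halves)
    show "summable (\<lambda>n. \<bar>g (int n)\<bar>)"
    proof (rule summable_comparison_test'[where N = 0])
      show "summable (\<lambda>n. M * p ^ n)"
        using p_pos p_less by (intro summable_mult summable_geometric) auto
    qed (use M in \<open>auto simp: g_def r_def\<close>)
    have "summable (\<lambda>n. \<bar>g (- int (Suc n))\<bar>)"
    proof -
      have "summable (\<lambda>n. 2 ^ Suc n * \<bar>bessel (- int (Suc n))\<bar>)"
        using summable_bessel_neg[of 2] by (subst summable_Suc_iff) simp
      moreover have "\<bar>g (- int (Suc n))\<bar> = 2 ^ Suc n * \<bar>bessel (- int (Suc n))\<bar>" for n
      proof -
        have "(1 / 2 :: real) powi (- int (Suc n)) = 2 ^ Suc n"
          by (simp only: power_int_minus power_int_of_nat) (simp add: power_one_over)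
        thus ?thesis by (simp add: g_def r_def abs_mult)
      qed
      ultimately show ?thesis by simp
    qed
    thus "summable (\<lambda>n. \<bar>g (- int n)\<bar>)"
      by (subst (asm) summable_Suc_iff)
  qed
  have bound: "1 / (1 - u) - B \<le> mellin u" if u: "1 / 2 < u" "u < 1" for u
  proof -
    have le: "\<bar>u powi k * r k\<bar> \<le> g k" for k
    proof -
      have "u powi k \<le> (if k \<ge> 0 then 1 else (1/2) powi k)"
        using u power_int_le_one[of u k] power_int_antimono[of "1/2" u k] by auto
      thus ?thesis using u by (auto simp: g_def abs_mult mult_right_mono)
    qed
    hence sr: "(\<lambda>k. norm (u powi k * r k)) summable_on UNIV"
      using g by (intro Infinite_Sum.abs_summable_on_comparison_test') auto
    have "((\<lambda>n. u ^ n) has_sum 1 / (1 - u)) UNIV"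
      using u by (intro norm_summable_imp_has_sum summable_geometric geometric_sums) auto
    hence "((\<lambda>k. u powi k) has_sum 1 / (1 - u)) (range int)"
      by (subst has_sum_reindex) (auto simp: o_def)
    hence geo: "((\<lambda>k. u powi k * (if k \<ge> 0 then 1 else 0)) has_sum 1 / (1 - u)) UNIV"
      by (rule iffD1[OF has_sum_cong_neutral, rotated -1]) (auto simp: image_iff, metis nonneg_int_cases not_le)
    have "((\<lambda>k. u powi k * (if k \<ge> 0 then 1 else 0) + u powi k * r k) has_sum 
        1 / (1 - u) + (\<Sum>\<^sub>\<infinity>k. u powi k * r k)) UNIV"
      by (rule has_sum_add[OF geo has_sum_infsum[OF abs_summable_summable[OF sr]]])
    moreover have "u powi k * (if k \<ge> 0 then 1 else 0) + u powi k * r k = u powi k * bessel k" for k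
      by (simp add: r_def algebra_simps)
    ultimately have "mellin u = 1 / (1 - u) + (\<Sum>\<^sub>\<infinity>k. u powi k * r k)"
      using has_sum_mellin[of u] u by (simp add: has_sum_unique)
    moreover have "\<bar>\<Sum>\<^sub>\<infinity>k. u powi k * r k\<bar> \<le> (\<Sum>\<^sub>\<infinity>k. \<bar>u powi k * r k\<bar>)"
      using norm_infsum_bound[OF sr] by simp
    moreover have "(\<Sum>\<^sub>\<infinity>k. \<bar>u powi k * r k\<bar>) \<le> B"
      unfolding B_def using sr le by (intro infsum_mono g) auto
    ultimately show ?thesis by linarith
  qed
  define u0 where "u0 = max (1 / 2) (1 - 1 / (\<bar>B\<bar> + 1))"
  show ?thesis
  proof (intro exI conjI allI impI)
    show "u0 < 1" by (simp add: u0_def add_nonneg_pos)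
    fix u assume u: "u0 < u \<and> u < 1"
    hence "1 - u < 1 / (\<bar>B\<bar> + 1)" "1 / 2 < u" by (auto simp: u0_def)
    hence "\<bar>B\<bar> + 1 < 1 / (1 - u)"
      using u by (simp add: field_simps)
    thus "0 < mellin u"
      using bound[of u] u \<open>1 / 2 < u\<close> by linarith
  qed
qed

text \<open>If \<open>mellin\<close> vanished between \<open>a\<close> and \<open>min 1 (a / p)\<close>, the functional equation would carry the zeros
  from each interval \<open>(a / p\<^bsup>j\<^esup>, a / p\<^bsup>j+1\<^esup>)\<close> to the next one within the unit interval: the factor
  \<open>u - a / p\<close> vanishes only at an endpoint of such an interval. The last of these intervals reaches up
  to 1, where \<open>mellin\<close> is positive.\<close>

lemma mellin_nonzero_in_strip: "\<exists>u. a < u \<and> u < 1 \<and> u < a / p \<and> mellin u \<noteq> 0"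
proof (rule ccontr)
  assume "\<not> ?thesis"
  hence z: "mellin u = 0" if "a < u" "u < 1" "u < a / p" for u
    using that by blast
  have vanish: "\<forall>u. a / p ^ j < u \<and> u < 1 \<and> u < a / p ^ Suc j \<longrightarrow> mellin u = 0" for j
  proof (induction j)
    case (Suc j)
    show ?case
    proof (intro allI impI)
      fix u assume u: "a / p ^ Suc j < u \<and> u < 1 \<and> u < a / p ^ Suc (Suc j)"
      have "a / p \<le> a / p ^ Suc j"
        using p_pos p_less a_pos by (intro divide_left_mono) (auto simp: mult_left_le power_le_one)
      moreover have "0 < a / p ^ Suc j"
        using a_pos p_pos by simp
      ultimately have ne: "u \<noteq> a / p" "0 < u"
        using u by linarith+
      have "a / p ^ j < u * p" "u * p < 1" "u * p < a / p ^ Suc j"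
        using u ne p_pos p_less mult_strict_mono[of u 1 p 1] by (auto simp: field_simps)
      hence "mellin (u * p) = 0" using Suc by blast
      thus "mellin u = 0"
        using mellin_functional[of u] u ne by auto
    qed
  qed (use z in auto)
  obtain j0 where "p ^ j0 < a"
    using real_arch_pow_inv[OF a_pos p_less] by blast
  \<comment> \<open>The interval with index \<open>i = j - 1\<close> is the one that contains points arbitrarily close to 1.\<close>
  define j where "j = (LEAST j. p ^ j \<le> a)"
  have j: "p ^ j \<le> a"
    unfolding j_def by (rule LeastI[of _ j0]) (use \<open>p ^ j0 < a\<close> in auto)
  have "j \<noteq> 0" using j a_less by (intro notI) auto
  then obtain i where i: "j = Suc i" by (auto simp: gr0_conv_Suc)
  have "\<not> p ^ i \<le> a"
    using not_less_Least[of i "\<lambda>j. p ^ j \<le> a"] i by (simp add: j_def)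
  hence lo: "a / p ^ i < 1" using p_pos by (simp add: field_simps)
  have hi: "1 \<le> a / p ^ Suc i" using j i p_pos by (simp add: field_simps)
  obtain u0 where u0: "u0 < 1" "\<And>u. u0 < u \<Longrightarrow> u < 1 \<Longrightarrow> 0 < mellin u"
    using mellin_pos_near_1 by blast
  obtain u where "max u0 (a / p ^ i) < u" "u < 1"
    using dense[of "max u0 (a / p ^ i)" 1] u0 lo by auto
  thus False
    using u0(2)[of u] vanish[of i] hi by force
qed

text \<open>The generating function of the convolution defining \<open>macdonald\<close>, the sum of
  \<open>u\<^bsup>-n\<^esup> * macdonald n\<close>, factors as the sum of \<open>u\<^bsup>-m\<^esup> * weight m\<close> times \<open>mellin u\<close>. The first factor
  converges exactly for \<open>a < u < a / p\<close> and is positive; the second one requires \<open>u < 1\<close>.\<close>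

lemma macdonald_nontrivial: "\<exists>n. macdonald n \<noteq> 0"
proof (rule ccontr)
  assume "\<not> ?thesis"
  hence macdonald_0: "macdonald n = 0" for n by blast
  obtain u where u: "a < u" "u < 1" "u < a / p" "mellin u \<noteq> 0"
    using mellin_nonzero_in_strip by blast
  have u_pos: "0 < u" using u a_pos by linarith
  define F where "F m = u powi (- m) * weight m" for m
  have F_pos: "0 < F m" for m
    using u_pos weight_pos by (simp add: F_def)
  have F: "F summable_on UNIV"
  proof (rule summable_on_int_halves)
    show "summable (\<lambda>n. \<bar>F (int n)\<bar>)"
    proof (rule summable_comparison_test'[where N = 0])
      show "summable (\<lambda>n. (a / u) ^ n)"
        using u u_pos a_pos by (intro summable_geometric) auto
      show "norm \<bar>F (int n)\<bar> \<le> (a / u) ^ n" for n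
        using mult_left_mono[OF weight_le[of "int n"], of "u powi (- int n)"] u_pos F_pos[of "int n"]
        by (simp add: F_def power_int_minus power_mult_distrib power_inverse divide_inverse mult.commute)
    qed
    show "summable (\<lambda>n. \<bar>F (- int n)\<bar>)"
    proof (rule summable_comparison_test'[where N = 0])
      show "summable (\<lambda>n. (u * p / a) ^ n)"
        using u u_pos a_pos p_pos by (intro summable_geometric) (auto simp: field_simps)
      show "norm \<bar>F (- int n)\<bar> \<le> (u * p / a) ^ n" for n
      proof -
        have "weight (- int n) = (p / a) ^ n / (1 + p ^ n)"
          using p_pos a_pos by (simp add: weight_def power_int_minus field_simps)
        also have "\<dots> \<le> (p / a) ^ n"
          using p_pos a_pos add_pos_pos[of 1 "p ^ n"] by (simp add: divide_le_eq algebra_simps)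
        finally have "u ^ n * weight (- int n) \<le> u ^ n * (p / a) ^ n"
          using u_pos by (intro mult_left_mono) auto
        thus ?thesis
          using F_pos[of "- int n"] by (simp add: F_def power_mult_distrib power_divide)
      qed
    qed
  qed
  have "(\<lambda>(m, k). F m * (u powi k * bessel k)) summable_on UNIV \<times> UNIV"
    using F summable_bessel[OF u_pos u(2)] by (rule summable_on_product_dominated) (auto simp: abs_mult)
  hence "(\<lambda>(m, n). F m * (u powi (m - n) * bessel (m - n))) summable_on UNIV \<times> UNIV"
    by (subst (asm) summable_on_reindex_bij_witness[where i = "\<lambda>(m, k). (m, m - k)" and j = "\<lambda>(m, k). (m, m - k)"
        and h = "\<lambda>(m, n). F m * (u powi (m - n) * bessel (m - n))" and T = "UNIV \<times> UNIV"]) auto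
  hence swap: "(\<Sum>\<^sub>\<infinity>m. \<Sum>\<^sub>\<infinity>n. F m * (u powi (m - n) * bessel (m - n))) = 
      (\<Sum>\<^sub>\<infinity>n. \<Sum>\<^sub>\<infinity>m. F m * (u powi (m - n) * bessel (m - n)))"
    by (rule infsum_swap_banach)
  have inner_m: "(\<Sum>\<^sub>\<infinity>m. F m * (u powi (m - n) * bessel (m - n))) = 0" for n
  proof -
    have "F m * (u powi (m - n) * bessel (m - n)) = u powi (- n) * (weight m * bessel (m - n))" for m
      using u_pos by (simp add: F_def power_int_minus power_int_diff divide_inverse)
    thus ?thesis
      by (simp only: infsum_cmult_right' macdonald_def[symmetric] macdonald_0 mult_zero_right)
  qed
  have inner_n: "(\<Sum>\<^sub>\<infinity>n. F m * (u powi (m - n) * bessel (m - n))) = F m * mellin u" for m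
  proof -
    have "(\<Sum>\<^sub>\<infinity>n. u powi (m - n) * bessel (m - n)) = mellin u"
      unfolding mellin_def
      by (rule infsum_reindex_bij_witness[where i = "\<lambda>k. m - k" and j = "\<lambda>k. m - k"]) auto
    thus ?thesis by (simp add: infsum_cmult_right')
  qed
  have "infsum F UNIV * mellin u = 0"
    using swap unfolding inner_m inner_n infsum_cmult_left' by simp
  moreover have "0 < infsum F UNIV"
    using finite_sum_le_infsum[OF F, of "{0}"] F_pos less_le_trans[OF F_pos[of 0]] by (simp add: less_imp_le)
  ultimately show False using u by simp
qed

text \<open>Boundedness and nontriviality make \<open>macdonald\<close> a minimal solution of its recurrence.\<close>

lemma macdonald_same_sign: "0 < macdonald (n - 1) * macdonald n"
  and macdonald_decay: "\<bar>macdonald n\<bar> < a / p * p powi n * \<bar>macdonald (n - 1)\<bar>"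
proof -
  obtain B where B: "\<And>n. \<bar>macdonald (int n)\<bar> \<le> B" using macdonald_bounded by blast
  obtain n0 where n0: "macdonald n0 \<noteq> 0" using macdonald_nontrivial by blast
  have b: "0 < a / p" using a_pos p_pos by simp
  note * = minimal_solution_decay[where y = macdonald and B = B and b = "a / p" and p = p, OF b p_pos p_less macdonald_recurrence B n0]
  show "0 < macdonald (n - 1) * macdonald n" "\<bar>macdonald n\<bar> < a / p * p powi n * \<bar>macdonald (n - 1)\<bar>"
    by (rule *)+
qed

end

section \<open>Back to the original functions\<close>

text \<open>This makes the normalizing constant of the q-Macdonald function positive.\<close>

lemma qpoch_inf_pos:
  assumes "0 \<le> x" "x < 1" "0 < p" "p < 1"
  shows "0 < qpoch_inf x p"
proof -
  have pos: "0 < 1 - x * p ^ i" for i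
  proof -
    have "x * p ^ i \<le> x"
      using assms by (intro mult_left_le power_le_one) auto
    thus ?thesis using assms by linarith
  qed
  have "summable (\<lambda>i. norm (1 - x * p ^ i - 1))"
    using assms by (auto simp: abs_mult intro!: summable_mult summable_geometric)
  hence "convergent_prod (\<lambda>i. 1 - x * p ^ i)"
    by (intro abs_convergent_prod_imp_convergent_prod summable_imp_abs_convergent_prod)
  thus ?thesis
    unfolding qpoch_inf_def using pos by (intro less_0_prodinf) auto
qed

context
  fixes q \<nu> :: real
  assumes q: "0 < q" "q < 1" and nu: "\<nu> > -1"
begin

interpretation q_bessel_base "q\<^sup>2" "q powr (2 * \<nu> + 2)"
proof
  show "q\<^sup>2 < 1"
    using q by (simp add: power_less_one_iff)
  show "q powr (2 * \<nu> + 2) < 1"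
    using q nu powr_less_mono'[of q 0 "2 * \<nu> + 2"] by simp
qed (use q in auto)

lemma q_bessel_eq_bessel: "q_bessel q \<nu> (q powi k) = bessel k"
  unfolding q_bessel_def bessel_def phi_def
proof (rule suminf_cong)
  fix n
  have "q ^ (n * (n + 1)) = (q\<^sup>2) ^ (n choose 2) * (q\<^sup>2) ^ n"
  proof -
    have "n * (n + 1) = 2 * (n choose 2) + 2 * n"
      by (induction n) (auto simp: choose_two_Suc numeral_2_eq_2)
    thus ?thesis by (simp add: power_add power_mult)
  qed
  moreover have "((q\<^sup>2) powi (k + 1)) ^ n = (q powi k) ^ (2 * n) * (q\<^sup>2) ^ n"
    using q by (simp add: power_int_add_1 power_mult_distrib power_mult flip: power_int_mult)
      (simp add: power_int_power power_int_power' mult_ac flip: power_mult)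
  ultimately show "(- 1) ^ n * (q ^ (n * (n + 1)) / (qpoch (q\<^sup>2) (q\<^sup>2) n *
      qpoch (q powr (2 * \<nu> + 2)) (q\<^sup>2) n)) * (q powi k) ^ (2 * n) =
    euler_coeff n / qpoch (q powr (2 * \<nu> + 2)) (q\<^sup>2) n * ((q\<^sup>2) powi (k + 1)) ^ n"
    by (simp add: euler_coeff_def)
qed

lemma q_macdonald_eq_macdonald:
  "q_macdonald q \<nu> (q powi (- n)) = q_bessel_const q \<nu> * (1 - q) * macdonald n"
proof -
  have "q powi m * (inverse (1 + (q powi m)\<^sup>2) * q_bessel q \<nu> (q powi m * q powi (- n))
      * (q powi m) powr (2 * \<nu> + 1)) = weight m * bessel (m - n)" for m
  proof -
    have arg: "q powi m * q powi (- n) = q powi (m - n)"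
      using q power_int_add[of q m "- n"] by simp
    have pow: "q powi m * (q powi m) powr (2 * \<nu> + 1) = (q powr (2 * \<nu> + 2)) powi m"
      using q by (simp add: powr_real_of_int' [symmetric] powr_powr flip: powr_add)
        (simp add: algebra_simps)
    have sq: "(q powi m)\<^sup>2 = (q\<^sup>2) powi m"
      by (simp add: power_int_power power_int_power' mult.commute)
    have "x * (inverse d * j * y) = x * y / d * j" for x d j y :: real
      by (simp add: divide_inverse)
    thus ?thesis
      by (simp only: arg pow sq q_bessel_eq_bessel weight_def)
  qed
  thus ?thesis
    by (simp add: q_macdonald_def jackson_integral_def macdonald_def)
qed

lemma q_macdonald_consecutive:
  fixes n :: int
  defines "K \<equiv> \<lambda>n. q_macdonald q \<nu> (q powi (- n))"
  shows "0 < K (n - 1) * K n" and "\<bar>K n\<bar> < q powr (2 * \<nu>) * q powi (2 * n) * \<bar>K (n - 1)\<bar>"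
proof -
  define C where "C = q_bessel_const q \<nu> * (1 - q)"
  have C: "0 < C"
    using q qpoch_inf_pos[OF less_imp_le[OF a_pos] a_less p_pos p_less]
      qpoch_inf_pos[OF less_imp_le[OF p_pos] p_less p_pos p_less]
    by (simp add: C_def q_bessel_const_def)
  have K: "K n = C * macdonald n" for n
    by (simp add: K_def q_macdonald_eq_macdonald C_def)
  have "K (n - 1) * K n = C\<^sup>2 * (macdonald (n - 1) * macdonald n)"
    by (simp add: K power2_eq_square)
  thus "0 < K (n - 1) * K n"
    using C macdonald_same_sign[of n] by simp
  have "q powr (2 * \<nu> + 2) / q\<^sup>2 = q powr (2 * \<nu>)"
    using q by (simp add: powr_add)
  moreover have "(q\<^sup>2) powi n = q powi (2 * n)"
    by (simp add: power_int_mult)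
  ultimately have "\<bar>macdonald n\<bar> < q powr (2 * \<nu>) * q powi (2 * n) * \<bar>macdonald (n - 1)\<bar>"
    using macdonald_decay[of n] by simp
  from mult_strict_left_mono[OF this C] 
  show "\<bar>K n\<bar> < q powr (2 * \<nu>) * q powi (2 * n) * \<bar>K (n - 1)\<bar>"
    using C by (simp add: K abs_mult mult_ac)
qed

end

theorem corollary2:
  fixes q \<nu> :: real
  assumes "0 < q" and "q < 1" and "\<nu> > -1" and "\<nu> \<notin> \<nat>"
  shows "((\<forall>\<^sub>F n :: nat in sequentially. q_macdonald q \<nu> (q powi (- int n)) > 0) \<or>
          (\<forall>\<^sub>F n :: nat in sequentially. q_macdonald q \<nu> (q powi (- int n)) < 0))
       \<and> ((\<lambda>n :: nat. q_macdonald q \<nu> (q powi (- int n)) /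
                       q_macdonald q \<nu> (q powi (- int n + 1))) \<longlonglongrightarrow> 0)
       \<and> (\<exists>c \<sigma> :: real. c > 0 \<and> \<sigma> > 0 \<and>
            (\<forall>\<^sub>F n :: nat in sequentially.
               \<bar>q_macdonald q \<nu> (q powi (- int n))\<bar> < \<sigma> * c ^ n * q ^ (n\<^sup>2)))"
proof -
  define K where "K n = q_macdonald q \<nu> (q powi (- n))" for n
  define b where "b = q powr (2 * \<nu>)"
  have b: "0 < b" using assms by (simp add: b_def)
  have sign: "0 < K (n - 1) * K n" and decay: "\<bar>K n\<bar> < b * q powi (2 * n) * \<bar>K (n - 1)\<bar>" for n
    using q_macdonald_consecutive[OF assms(1-3), of n] by (simp_all add: K_def b_def)
  have nz: "K n \<noteq> 0" for n
    using sign[of n] by auto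
  have "0 < K 0 * K (int n)" for n
  proof (induction n)
    case 0
    show ?case using nz[of 0] by (simp add: mult_neg_neg zero_less_mult_iff) linarith
  next
    case (Suc n)
    thus ?case using sign[of "int (Suc n)"] by (auto simp: zero_less_mult_iff)
  qed
  hence "(\<forall>n::nat. K (int n) > 0) \<or> (\<forall>n::nat. K (int n) < 0)"
    by (auto simp: zero_less_mult_iff) (metis less_asym)
  hence 1: "(\<forall>\<^sub>F n in sequentially. K (int n) > 0) \<or> (\<forall>\<^sub>F n in sequentially. K (int n) < 0)"
    by (auto intro: always_eventually)
  have 2: "(\<lambda>n. K (int n) / K (int n - 1)) \<longlonglongrightarrow> 0"
  proof (rule Lim_null_comparison)
    have "\<bar>K (int n) / K (int n - 1)\<bar> \<le> b * (q\<^sup>2) ^ n" for n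
    proof -
      have "q powi (2 * int n) = (q\<^sup>2) ^ n"
        by (simp add: power_int_mult)
      thus ?thesis
        using decay[of "int n"] nz[of "int n - 1"] by (simp add: divide_le_eq)
    qed
    thus "\<forall>\<^sub>F n in sequentially. norm (K (int n) / K (int n - 1)) \<le> b * (q\<^sup>2) ^ n"
      by simp
    show "(\<lambda>n. b * (q\<^sup>2) ^ n) \<longlonglongrightarrow> 0"
      using assms by (intro tendsto_mult_right_zero LIMSEQ_realpow_zero) (auto simp: power_less_one_iff)
  qed
  have le: "\<bar>K (int n)\<bar> \<le> \<bar>K 0\<bar> * (b * q) ^ n * q ^ (n\<^sup>2)" for n
  proof (induction n)
    case (Suc n)
    have "\<bar>K (int (Suc n))\<bar> \<le> b * q ^ (2 * Suc n) * \<bar>K (int n)\<bar>"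
      using decay[of "int (Suc n)"] by (simp add: power_int_mult power_mult flip: power_int_of_nat)
    also have "\<dots> \<le> b * q ^ (2 * Suc n) * (\<bar>K 0\<bar> * (b * q) ^ n * q ^ (n\<^sup>2))"
      using Suc b assms by (intro mult_left_mono) auto
    also have "\<dots> = \<bar>K 0\<bar> * (b * q) ^ Suc n * q ^ ((Suc n)\<^sup>2)"
    proof -
      have "(Suc n)\<^sup>2 = n\<^sup>2 + 2 * n + 1"
        by (simp add: power2_eq_square)
      thus ?thesis by (simp add: power_add mult_ac)
    qed
    finally show ?case .
  qed auto
  have 3: "\<bar>K (int n)\<bar> < (\<bar>K 0\<bar> + 1) * (b * q) ^ n * q ^ (n\<^sup>2)" for n
  proof -
    have "0 < (b * q) ^ n * q ^ (n\<^sup>2)"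
      using b assms by simp
    thus ?thesis using le[of n] by (simp add: algebra_simps)
  qed
  have "\<exists>c \<sigma> :: real. c > 0 \<and> \<sigma> > 0 \<and>
      (\<forall>\<^sub>F n :: nat in sequentially. \<bar>K (int n)\<bar> < \<sigma> * c ^ n * q ^ (n\<^sup>2))"
    using 3 b assms
    by (intro exI[of _ "b * q"] exI[of _ "\<bar>K 0\<bar> + 1"]) (auto intro: always_eventually add_nonneg_pos)
  moreover have "- int n + 1 = - (int n - 1)" for n by simp
  ultimately show ?thesis
    using 1 2 unfolding K_def by presburger
qed

end
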